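(* Let $\mathcal{H}$ be a separable Hilbert space, $K\in B(\mathcal{H})$, $W=\{(W_i,\omega_i)\}_{i\in I}$ a $K$-fusion frame for $\mathcal{H}$, and let $X\in B(\mathcal{H},\sum_{i\in I}\oplus W_i)$ be an operator with $T_WX=K$. For $i\in I$ let $X_i\in B(\mathcal{H},W_i)$ be the $i$-th component of $X$, i.e. $X_if=(Xf)_i$. If $\widehat{W}=\{X_i^*W_i\}_{i\in I}$ (with all weights equal to $1$) is a Bessel fusion sequence, then $\widehat{W}$ is a $QK$-dual of $W$.
   Context: $I$ is a countable index set; $\pi_V$ is the orthogonal projection onto a closed subspace $V$. A family $\{(V_i,\upsilon_i)\}_{i\in I}$ of closed subspaces $V_i\subseteq\mathcal{H}$ with weights $\upsilon_i>0$ is a Bessel fusion sequence if there is $B<\infty$ with $\sum_i\upsilon_i^2\|\pi_{V_i}f\|^2\le B\|f\|^2$ for all $f\in\mathcal{H}$; it is a $K$-fusion frame if moreover there is $A>0$ with $A\|K^*f\|^2\le\sum_i\upsilon_i^2\|\pi_{V_i}f\|^2$ for all $f\in\mathcal{H}$. A family written $\{V_i\}_{i\in I}$ without weights has all weights $1$. $\sum_{i\in I}\oplus W_i$ is the Hilbert space of sequences $\{f_i\}_{i\in I}$ with $f_i\in W_i$ and $\sum_i\|f_i\|^2<\infty$, with inner product $\sum_i\langle f_i,g_i\rangle$. The synthesis operator of a Bessel fusion sequence $W$ is $T_W:\sum_{i}\oplus W_i\to\mathcal{H}$, $T_W\{f_i\}=\sum_i\omega_if_i$, with adjoint $T_W^*f=\{\omega_i\pi_{W_i}f\}_{i\in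 I}$. For a $K$-fusion frame $W$, a Bessel fusion sequence $V=\{(V_i,\upsilon_i)\}_{i\in I}$ is called a $QK$-dual of $W$ if there exists a bounded linear operator $Q:\sum_i\oplus W_i\to\sum_i\oplus V_i$ such that $T_WQ^*T_V^*=K$. *)

theory Defs
  imports "HOL-Analysis.Analysis" "HOL-Library.Function_Algebras"
begin

(* The scalar field of a Hilbert space: a complete real normed field is the reals or the
   complex numbers (Gelfand-Mazur), and mult_kcnj forces kcnj to be the identity, respectively
   complex conjugation. *)
class real_or_complex = real_normed_field + banach +
  fixes kcnj :: "'a \<Rightarrow> 'a"
  assumes kcnj_add: "kcnj (x + y) = kcnj x + kcnj y"
    and mult_kcnj: "x * kcnj x = (norm x)\<^sup>2 *\<^sub>R 1"

instantiation real :: real_or_complex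
begin
definition kcnj_real :: "real \<Rightarrow> real" where "kcnj_real x = x"
instance by standard (simp_all add: kcnj_real_def power2_eq_square)
end

instantiation complex :: real_or_complex
begin
definition kcnj_complex :: "complex \<Rightarrow> complex" where "kcnj_complex = cnj"
instance by standard (simp_all only: kcnj_complex_def complex_cnj_add complex_norm_square [symmetric] scaleR_conv_of_real mult_1_right)
end

(* Spaces are given by a carrier, since direct sums and subspaces are not types; addition is
   that of the ambient type and the norm is the one induced by the inner product. *)
record ('k, 'v) ip_space =
  carrier :: "'v set"
  scl :: "'k \<Rightarrow> 'v \<Rightarrow> 'v"
  ip :: "'v \<Rightarrow> 'v \<Rightarrow> 'k"

definition nrm :: "('k::real_normed_field, 'v) ip_space \<Rightarrow> 'v \<Rightarrow> real" where
  "nrm S x = sqrt (norm (ip S x x))"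

(* The ambient space fills a whole type, whose norm, real scaling and topology must be the
   ones coming from the inner product; completeness is that of the type class banach. *)
definition hilbert_space :: "('k::real_or_complex, 'h::banach) ip_space \<Rightarrow> bool" where
  "hilbert_space H \<longleftrightarrow>
     carrier H = UNIV \<and> vector_space (scl H) \<and>
     (\<forall>r x. scl H (of_real r) x = r *\<^sub>R x) \<and>
     (\<forall>x y z. ip H (x + y) z = ip H x z + ip H y z) \<and>
     (\<forall>c x y. ip H (scl H c x) y = c * ip H x y) \<and>
     (\<forall>x y. ip H y x = kcnj (ip H x y)) \<and>
     (\<forall>x. ip H x x = of_real ((norm x)\<^sup>2))"

lemma hilbert_space_real_inner:
  "hilbert_space \<lparr>carrier = UNIV, scl = scaleR,
     ip = (inner :: 'h::{real_inner, banach} \<Rightarrow> 'h \<Rightarrow> real)\<rparr>"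
  by (auto simp: hilbert_space_def kcnj_real_def inner_add_left inner_add_right inner_commute
      power2_norm_eq_inner real_vector.vector_space_axioms)

lemma hilbert_space_complex:
  "hilbert_space \<lparr>carrier = UNIV, scl = (*), ip = (\<lambda>x y :: complex. x * cnj y)\<rparr>"
  by (auto simp: hilbert_space_def kcnj_complex_def vector_space_def scaleR_conv_of_real
      algebra_simps complex_norm_square simp del: of_real_power)

definition bounded_op ::
  "('k::real_normed_field, 'a::plus) ip_space \<Rightarrow> ('k, 'b::plus) ip_space \<Rightarrow> ('a \<Rightarrow> 'b) \<Rightarrow> bool" where
  "bounded_op S T F \<longleftrightarrow>
     F \<in> carrier S \<rightarrow> carrier T \<and>
     (\<forall>x\<in>carrier S. \<forall>y\<in>carrier S. F (x + y) = F x + F y) \<and>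
     (\<forall>c. \<forall>x\<in>carrier S. F (scl S c x) = scl T c (F x)) \<and>
     (\<exists>C. \<forall>x\<in>carrier S. nrm T (F x) \<le> C * nrm S x)"

(* Only the values on the carrier of T are determined. *)
definition adj ::
  "('k, 'a) ip_space \<Rightarrow> ('k, 'b) ip_space \<Rightarrow> ('a \<Rightarrow> 'b) \<Rightarrow> ('b \<Rightarrow> 'a)" where
  "adj S T F = (SOME G. G \<in> carrier T \<rightarrow> carrier S \<and>
     (\<forall>x\<in>carrier S. \<forall>y\<in>carrier T. ip T (F x) y = ip S x (G y)))"

definition ip_subspace :: "('k, 'h) ip_space \<Rightarrow> 'h set \<Rightarrow> ('k, 'h) ip_space" where
  "ip_subspace H V = H\<lparr>carrier := V\<rparr>"

definition closed_subspace :: "('k::field, 'h::{ab_group_add, topological_space}) ip_space \<Rightarrow> 'h set \<Rightarrow> bool" where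
  "closed_subspace H V \<longleftrightarrow> module.subspace (scl H) V \<and> closed V"

definition proj :: "('k::zero, 'h::minus) ip_space \<Rightarrow> 'h set \<Rightarrow> 'h \<Rightarrow> 'h" where
  "proj H V f = (THE g. g \<in> V \<and> (\<forall>v\<in>V. ip H (f - g) v = 0))"

(* A family over I is a function on the whole index type; to make its members unique it is 0
   off I. *)
definition direct_sum ::
  "('k::real_normed_field, 'h::real_normed_vector) ip_space \<Rightarrow> 'i set \<Rightarrow> ('i \<Rightarrow> 'h set) \<Rightarrow> ('k, 'i \<Rightarrow> 'h) ip_space" where
  "direct_sum H I W =
     \<lparr>carrier = {f. (\<forall>i\<in>I. f i \<in> W i) \<and> (\<forall>i. i \<notin> I \<longrightarrow> f i = 0) \<and>
                    (\<lambda>i. (norm (f i))\<^sup>2) summable_on I},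
      scl = (\<lambda>c f i. scl H c (f i)),
      ip = (\<lambda>f g. \<Sum>\<^sub>\<infinity>i\<in>I. ip H (f i) (g i))\<rparr>"

(* infsum of a divergent family is 0, hence the explicit summability requirement. *)
definition bessel_fusion_sequence ::
  "('k::field, 'h::real_normed_vector) ip_space \<Rightarrow> 'i set \<Rightarrow> ('i \<Rightarrow> 'h set) \<Rightarrow> ('i \<Rightarrow> real) \<Rightarrow> bool" where
  "bessel_fusion_sequence H I V \<upsilon> \<longleftrightarrow>
     (\<forall>i\<in>I. closed_subspace H (V i) \<and> \<upsilon> i > 0) \<and>
     (\<exists>B. \<forall>f. (\<lambda>i. (\<upsilon> i)\<^sup>2 * (norm (proj H (V i) f))\<^sup>2) summable_on I \<and>
              (\<Sum>\<^sub>\<infinity>i\<in>I. (\<upsilon> i)\<^sup>2 * (norm (proj H (V i) f))\<^sup>2) \<le> B * (norm f)\<^sup>2)"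

definition K_fusion_frame ::
  "('k::field, 'h::real_normed_vector) ip_space \<Rightarrow> 'i set \<Rightarrow> ('h \<Rightarrow> 'h) \<Rightarrow> ('i \<Rightarrow> 'h set) \<Rightarrow> ('i \<Rightarrow> real) \<Rightarrow> bool" where
  "K_fusion_frame H I K V \<upsilon> \<longleftrightarrow>
     bessel_fusion_sequence H I V \<upsilon> \<and>
     (\<exists>A>0. \<forall>f. A * (norm (adj H H K f))\<^sup>2 \<le> (\<Sum>\<^sub>\<infinity>i\<in>I. (\<upsilon> i)\<^sup>2 * (norm (proj H (V i) f))\<^sup>2))"

definition synthesis :: "'i set \<Rightarrow> ('i \<Rightarrow> real) \<Rightarrow> ('i \<Rightarrow> 'h::real_normed_vector) \<Rightarrow> 'h" where
  "synthesis I \<omega> f = (\<Sum>\<^sub>\<infinity>i\<in>I. \<omega> i *\<^sub>R f i)"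

definition QK_dual ::
  "('k::real_normed_field, 'h::real_normed_vector) ip_space \<Rightarrow> 'i set \<Rightarrow> ('h \<Rightarrow> 'h) \<Rightarrow>
   ('i \<Rightarrow> 'h set) \<Rightarrow> ('i \<Rightarrow> real) \<Rightarrow> ('i \<Rightarrow> 'h set) \<Rightarrow> ('i \<Rightarrow> real) \<Rightarrow> bool" where
  "QK_dual H I K W \<omega> V \<upsilon> \<longleftrightarrow>
     K_fusion_frame H I K W \<omega> \<and> bessel_fusion_sequence H I V \<upsilon> \<and>
     (\<exists>Q. bounded_op (direct_sum H I W) (direct_sum H I V) Q \<and>
       (\<forall>f. synthesis I \<omega> (adj (direct_sum H I W) (direct_sum H I V) Q
              (adj (direct_sum H I V) H (synthesis I \<upsilon>) f)) = K f))"

end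

theory Submission
  imports Defs
begin

text \<open>
  Write \<open>X\<^sub>i\<close> for the \<open>i\<close>-th component of \<open>X\<close>. The dual is produced by the diagonal operator
  \<open>Q {f\<^sub>i} = {X\<^sub>i\<^sup>* f\<^sub>i}\<close>, which takes values in \<open>\<Oplus> What\<^sub>i\<close> by the very definition of
  \<open>What\<^sub>i = X\<^sub>i\<^sup>* W\<^sub>i\<close> and is bounded because \<open>\<parallel>X\<^sub>i\<^sup>*\<parallel> = \<parallel>X\<^sub>i\<parallel> \<le> \<parallel>X\<parallel>\<close>. Its adjoint is the
  diagonal operator \<open>{g\<^sub>i} \<mapsto> {X\<^sub>i g\<^sub>i}\<close> (\<open>adj_diagonal\<close>), and the adjoint of the synthesis operator
  of \<open>What\<close> sends \<open>f\<close> to its projections on the \<open>What\<^sub>i\<close> (\<open>adj_synthesis\<close>). The remainder of such a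
  projection is orthogonal to the range of \<open>X\<^sub>i\<^sup>*\<close>, hence killed by \<open>X\<^sub>i\<close>
  (\<open>bounded_op_proj_adj_range\<close>). So the composition of the two adjoints is \<open>X\<close> itself, and
  following it by the synthesis operator of \<open>W\<close> gives \<open>K\<close>.

  Most of the work is to see that these adjoints and projections exist, as they are defined by
  choice and description. For orthogonal projections this is the projection theorem, and for the
  \<open>X\<^sub>i\<close> the Riesz representation, which follows from it. For \<open>Q\<close> and the synthesis operator the
  adjoint is given by an explicit formula; checking the formula for the synthesis operator uses that
  its series converges unconditionally for every square summable family (\<open>bessel_summable\<close>).
\<close>

section \<open>Conjugation\<close>

lemma kcnj_0 [simp]: "kcnj 0 = (0 :: 'k::real_or_complex)"
  using kcnj_add[of "0::'k" 0] by simp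

lemma mult_kcnj_of_real: "x * kcnj x = (of_real ((norm x)\<^sup>2) :: 'k::real_or_complex)"
  by (simp only: mult_kcnj of_real_def)

lemma norm_kcnj [simp]: "norm (kcnj x) = norm (x :: 'k::real_or_complex)"
proof (cases "x = 0")
  case False
  have "norm x * norm (kcnj x) = norm x * norm x"
    by (simp add: mult_kcnj_of_real power2_eq_square flip: norm_mult)
  with False show ?thesis by simp
qed simp

lemma kcnj_mult: "kcnj (x * y) = kcnj x * kcnj (y :: 'k::real_or_complex)"
proof (cases "x * y = 0")
  case False
  have "(x * y) * kcnj (x * y) = (x * kcnj x) * (y * kcnj y)"
    by (simp add: mult_kcnj_of_real norm_mult power_mult_distrib)
  also have "\<dots> = (x * y) * (kcnj x * kcnj y)"
    by (simp add: ac_simps)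
  finally show ?thesis using False by (simp only: mult_cancel_left) simp
qed auto

lemma kcnj_of_real [simp]: "kcnj (of_real r) = (of_real r :: 'k::real_or_complex)"
proof (cases "r = 0")
  case False
  have "of_real r * kcnj (of_real r) = (of_real r * of_real r :: 'k)"
    by (simp add: mult_kcnj_of_real power2_eq_square)
  with False show ?thesis by simp
qed simp

lemma kcnj_kcnj [simp]: "kcnj (kcnj x) = (x :: 'k::real_or_complex)"
proof (cases "x = 0")
  case False
  then have "kcnj x \<noteq> 0" using norm_kcnj[of x] by (metis norm_eq_zero)
  moreover have "kcnj x * kcnj (kcnj x) = kcnj x * x"
    using mult_kcnj_of_real[of "kcnj x"] mult_kcnj_of_real[of x] by (simp add: ac_simps)
  ultimately show ?thesis by simp
qed simp

section \<open>Inner products\<close>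

text \<open>The definition of Hilbert space, packaged as a context so that the library of vector spaces
  applies to the scaling of the carrier.\<close>

locale hilbert =
  fixes H :: "('k::real_or_complex, 'h::banach) ip_space"
  assumes hilbert_space: "hilbert_space H"
begin

lemma carrier [simp]: "carrier H = UNIV"
  and scl_of_real: "scl H (of_real r) x = r *\<^sub>R x"
  and ip_add_left: "ip H (x + y) z = ip H x z + ip H y z"
  and ip_scl_left: "ip H (scl H c x) y = c * ip H x y"
  and ip_commute: "ip H y x = kcnj (ip H x y)"
  and ip_self: "ip H x x = of_real ((norm x)\<^sup>2)"
  using hilbert_space unfolding hilbert_space_def by blast+

sublocale vector_space "scl H"
  using hilbert_space by (simp add: hilbert_space_def)

lemma ip_add_right: "ip H x (y + z) = ip H x y + ip H x z"
  by (metis ip_commute ip_add_left kcnj_add)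

lemma ip_scl_right: "ip H x (scl H c y) = kcnj c * ip H x y"
  by (metis ip_commute ip_scl_left kcnj_mult)

lemma ip_diff_left: "ip H (x - y) z = ip H x z - ip H y z"
  using ip_add_left[of "x - y" y z] by (simp add: algebra_simps)

lemma ip_diff_right: "ip H x (y - z) = ip H x y - ip H x z"
  using ip_add_right[of x "y - z" z] by (simp add: algebra_simps)

lemma ip_zero_left [simp]: "ip H 0 x = 0"
  using ip_add_left[of 0 0 x] by simp

lemma ip_zero_right [simp]: "ip H x 0 = 0"
  using ip_add_right[of x 0 0] by simp

lemma ip_sum_left: "ip H (sum f F) z = (\<Sum>i\<in>F. ip H (f i) z)"
  by (induction F rule: infinite_finite_induct) (simp_all add: ip_add_left)

lemma ip_scaleR_left: "ip H (r *\<^sub>R x) y = r *\<^sub>R ip H x y"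
  by (metis ip_scl_left scl_of_real scaleR_conv_of_real)

lemma ip_self_eq_0 [simp]: "ip H x x = 0 \<longleftrightarrow> x = 0"
  by (simp add: ip_self)

lemma norm_sq_ip: "norm (ip H x x) = (norm x)\<^sup>2"
  by (simp add: ip_self norm_power)

lemma nrm_eq_norm: "nrm H x = norm x"
  by (simp add: nrm_def norm_sq_ip)

lemma ip_right_eqI:
  assumes "\<And>x. ip H x y = ip H x z"
  shows "y = z"
  using assms[of "y - z"] by (metis eq_iff_diff_eq_0 ip_diff_right ip_self_eq_0)

text \<open>This is Pythagoras for \<open>u\<close> split into its component along \<open>v\<close> and the remainder. Nonnegativity of the left-hand side is the Cauchy-Schwarz inequality, and the same
  identity shows that a nearest point of a subspace leaves an orthogonal remainder.\<close>

lemma norm_sq_diff_component: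
  assumes "v \<noteq> 0"
  shows "(norm (u - scl H (ip H u v / of_real ((norm v)\<^sup>2)) v))\<^sup>2
           = (norm u)\<^sup>2 - (norm (ip H u v))\<^sup>2 / (norm v)\<^sup>2"
proof -
  define c where "c = ip H u v / of_real ((norm v)\<^sup>2)"
  have nz: "of_real ((norm v)\<^sup>2) \<noteq> (0 :: 'k)" using assms by simp
  \<comment> \<open>the coefficient is chosen to make the difference orthogonal to \<open>v\<close>\<close>
  have orth: "ip H (u - scl H c v) v = 0"
    using nz by (simp add: ip_diff_left ip_scl_left c_def ip_self del: of_real_power)
  then have "of_real ((norm (u - scl H c v))\<^sup>2) = ip H (u - scl H c v) u"
    by (simp only: ip_self[symmetric]) (simp add: ip_diff_right[of _ u] ip_scl_right)
  also have "\<dots> = of_real ((norm u)\<^sup>2) - ip H u v * kcnj (ip H u v) / of_real ((norm v)\<^sup>2)"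
    by (simp add: ip_diff_left ip_scl_left c_def ip_self ip_commute[of v u])
  also have "\<dots> = of_real ((norm u)\<^sup>2 - (norm (ip H u v))\<^sup>2 / (norm v)\<^sup>2)"
    by (simp add: mult_kcnj_of_real)
  finally show ?thesis by (simp only: of_real_eq_iff c_def)
qed

lemma Cauchy_Schwarz: "norm (ip H u v) \<le> norm u * norm v"
proof (cases "v = 0")
  case False
  have "0 \<le> (norm u)\<^sup>2 - (norm (ip H u v))\<^sup>2 / (norm v)\<^sup>2"
    using norm_sq_diff_component[OF False, of u] by (metis zero_le_power2)
  then have "(norm (ip H u v))\<^sup>2 \<le> (norm u * norm v)\<^sup>2"
    using False by (simp add: field_simps)
  then show ?thesis by (rule power2_le_imp_le) simp
qed simp

lemma bounded_linear_ip_left: "bounded_linear (\<lambda>x. ip H x y)"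
  by (rule bounded_linear_intro[where K = "norm y"])
    (simp_all add: ip_add_left ip_scaleR_left Cauchy_Schwarz)

lemma parallelogram:
  fixes x y :: 'h
  shows "(norm (x + y))\<^sup>2 + (norm (x - y))\<^sup>2 = 2 * (norm x)\<^sup>2 + 2 * (norm y)\<^sup>2"
proof -
  have "ip H (x + y) (x + y) + ip H (x - y) (x - y) = of_real 2 * ip H x x + of_real 2 * ip H y y"
    by (simp add: ip_add_left ip_add_right ip_diff_left ip_diff_right)
  then show ?thesis
    by (simp only: ip_self of_real_add[symmetric] of_real_mult[symmetric] of_real_eq_iff)
qed

section \<open>Orthogonal projection and the Riesz representation\<close>

lemma projection_unique:
  assumes "subspace V" "g \<in> V" "g' \<in> V"
    and "\<And>v. v \<in> V \<Longrightarrow> ip H (f - g) v = 0" "\<And>v. v \<in> V \<Longrightarrow> ip H (f - g') v = 0"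
  shows "g = g'"
proof -
  have "g - g' \<in> V" using assms by (simp add: subspace_diff)
  then have "ip H ((f - g') - (f - g)) (g - g') = 0"
    by (simp only: ip_diff_left[of "f - g'"] assms(4,5) diff_self)
  then show ?thesis by simp
qed

text \<open>A minimizing sequence for the distance from \<open>f\<close> to \<open>V\<close> is Cauchy by the parallelogram law,
  because the midpoint of two of its members is no closer to \<open>f\<close> than the infimum. Its limit is a
  nearest point, and a nonzero component of the remainder along some \<open>v \<in> V\<close> could be subtracted
  to get closer still.\<close>

lemma projection_exists:
  assumes "closed_subspace H V"
  obtains g where "g \<in> V" "\<And>v. v \<in> V \<Longrightarrow> ip H (f - g) v = 0"
proof -
  have sub: "subspace V" and cl: "closed V"
    using assms by (auto simp: closed_subspace_def)
  define d where "d = (INF v\<in>V. (norm (f - v))\<^sup>2)"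
  have ne: "V \<noteq> {}" using subspace_0[OF sub] by auto
  have bdd: "bdd_below ((\<lambda>v. (norm (f - v))\<^sup>2) ` V)"
    by (rule bdd_belowI2[where m = 0]) simp
  have d_le: "d \<le> (norm (f - v))\<^sup>2" if "v \<in> V" for v
    unfolding d_def by (rule cINF_lower[OF bdd that])
  have "\<exists>v\<in>V. (norm (f - v))\<^sup>2 < d + 1 / Suc n" for n
    using cINF_less_iff[OF ne bdd, of "d + 1 / Suc n"] by (simp add: d_def)
  then obtain s where s: "\<And>n. s n \<in> V" "\<And>n. (norm (f - s n))\<^sup>2 < d + 1 / Suc n"
    by metis
  have mid: "(1/2) *\<^sub>R (s m + s n) \<in> V" for m n
    using subspace_scale[OF sub subspace_add[OF sub s(1)[of m] s(1)[of n]], of "of_real (1/2)"]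
    by (simp only: scl_of_real)
  have close: "(norm (s m - s n))\<^sup>2 \<le> 2 * (1 / Suc m) + 2 * (1 / Suc n)" for m n
  proof -
    have "(f - s n) + (f - s m) = 2 *\<^sub>R (f - (1/2) *\<^sub>R (s m + s n))"
      by (simp add: algebra_simps scaleR_2)
    then have "4 * d \<le> (norm ((f - s n) + (f - s m)))\<^sup>2"
      using d_le[OF mid[of m n]] by (simp add: power_mult_distrib)
    also have "\<dots> = 2 * (norm (f - s n))\<^sup>2 + 2 * (norm (f - s m))\<^sup>2 - (norm (s m - s n))\<^sup>2"
      using parallelogram[of "f - s n" "f - s m"] by simp
    finally show ?thesis
      using s(2)[of m] s(2)[of n] by linarith
  qed
  have "Cauchy s"
  proof (rule metric_CauchyI)
    fix e :: real assume e: "e > 0"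
    then obtain M where M: "4 / e\<^sup>2 < of_nat M" using reals_Archimedean2 by blast
    have "dist (s m) (s n) < e" if "m \<ge> M" "n \<ge> M" for m n
    proof -
      have "2 / real (Suc k) < e\<^sup>2 / 2" if "k \<ge> M" for k
      proof -
        have "4 / e\<^sup>2 < real (Suc k)" using M that by linarith
        then show ?thesis using e by (simp add: field_simps)
      qed
      from this[OF \<open>m \<ge> M\<close>] this[OF \<open>n \<ge> M\<close>] close[of m n]
      have "(norm (s m - s n))\<^sup>2 < e\<^sup>2" by linarith
      then show ?thesis using e by (simp add: dist_norm power2_less_imp_less)
    qed
    then show "\<exists>M. \<forall>m\<ge>M. \<forall>n\<ge>M. dist (s m) (s n) < e" by blast
  qed
  then obtain g where g: "s \<longlonglongrightarrow> g" using Cauchy_convergent convergent_def by blast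
  have gV: "g \<in> V" using closed_sequentially[OF cl s(1) g] .
  have "(\<lambda>n. (norm (f - s n))\<^sup>2) \<longlonglongrightarrow> (norm (f - g))\<^sup>2"
    by (intro tendsto_intros g)
  moreover have "(\<lambda>n. d + 1 / real (Suc n)) \<longlonglongrightarrow> d + 0"
    by (intro tendsto_intros LIMSEQ_Suc[OF lim_1_over_n])
  ultimately have min: "(norm (f - g))\<^sup>2 \<le> d"
    using LIMSEQ_le s(2) less_imp_le by (metis (mono_tags, lifting) add_0_right)
  show thesis
  proof (rule that[OF gV])
    fix v assume v: "v \<in> V"
    show "ip H (f - g) v = 0"
    proof (cases "v = 0")
      case False
      let ?c = "ip H (f - g) v / of_real ((norm v)\<^sup>2)"
      have "g + scl H ?c v \<in> V" using sub gV v by (simp add: subspace_add subspace_scale)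
      from d_le[OF this] have "d \<le> (norm ((f - g) - scl H ?c v))\<^sup>2"
        by (simp add: diff_diff_eq)
      with norm_sq_diff_component[OF False, of "f - g"] min
      have "(norm (ip H (f - g) v))\<^sup>2 / (norm v)\<^sup>2 \<le> 0" by simp
      then show ?thesis using False by (simp add: divide_le_0_iff)
    qed simp
  qed
qed

text \<open>Existence and uniqueness turn the description by \<open>THE\<close> into a usable projection.\<close>

lemma
  assumes "closed_subspace H V"
  shows proj_in: "proj H V f \<in> V"
    and proj_orth: "v \<in> V \<Longrightarrow> ip H (f - proj H V f) v = 0"
proof -
  obtain g where g: "g \<in> V" "\<And>v. v \<in> V \<Longrightarrow> ip H (f - g) v = 0"
    using projection_exists[OF assms] by blast
  have "subspace V" using assms by (simp add: closed_subspace_def)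
  have "\<exists>!g. g \<in> V \<and> (\<forall>v\<in>V. ip H (f - g) v = 0)"
    by (rule ex1I[of _ g]) (use g projection_unique[OF \<open>subspace V\<close>] in blast)+
  from theI'[OF this] show "proj H V f \<in> V" "v \<in> V \<Longrightarrow> ip H (f - proj H V f) v = 0"
    unfolding proj_def by blast+
qed

lemma proj_orth_right:
  assumes "closed_subspace H V" "v \<in> V"
  shows "ip H v (f - proj H V f) = 0"
  using proj_orth[OF assms] by (metis ip_commute kcnj_0)

text \<open>The kernel of a nonzero bounded functional is a closed subspace with a one-dimensional
  orthogonal complement: if \<open>u\<close> is orthogonal to the kernel and \<open>\<phi> u \<noteq> 0\<close>, then
  \<open>x - (\<phi> x / \<phi> u) u\<close> is in the kernel for every \<open>x\<close>, and pairing it with \<open>u\<close> expresses \<open>\<phi> x\<close>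
  by the inner product of \<open>x\<close> with a multiple of \<open>u\<close>.\<close>

lemma Riesz:
  assumes add: "\<And>x y. \<phi> (x + y) = \<phi> x + \<phi> y"
    and scl: "\<And>c x. \<phi> (scl H c x) = c * \<phi> x"
    and bound: "\<And>x. norm (\<phi> x) \<le> C * norm x"
  obtains y where "\<And>x. \<phi> x = ip H x y"
proof (cases "\<forall>x. \<phi> x = 0")
  case True
  then show thesis using that[of 0] by simp
next
  case False
  then obtain z where z: "\<phi> z \<noteq> 0" by blast
  have sclR: "\<phi> (r *\<^sub>R x) = r *\<^sub>R \<phi> x" for r x
    by (metis scl scl_of_real scaleR_conv_of_real)
  have lin: "bounded_linear \<phi>"
    using add sclR bound by (intro bounded_linear_intro[where K = C]) (auto simp: mult.commute)
  have diff: "\<phi> (x - y) = \<phi> x - \<phi> y" for x y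
    using add[of "x - y" y] by simp
  define N where "N = {x. \<phi> x = 0}"
  have "closed N" unfolding N_def
    by (intro closed_Collect_eq continuous_on_const linear_continuous_on lin)
  moreover have "subspace N"
    using add scl diff[of 0 0] by (auto simp: N_def subspace_def)
  ultimately have N: "closed_subspace H N" by (simp add: closed_subspace_def)
  define u where "u = z - proj H N z"
  have u: "\<phi> u = \<phi> z" using proj_in[OF N, of z] by (simp add: u_def diff N_def)
  have uu: "ip H u u \<noteq> 0" using u z diff[of 0 0] by auto
  have "\<phi> x = ip H x (scl H (kcnj (\<phi> u / ip H u u)) u)" for x
  proof -
    have "x - scl H (\<phi> x / \<phi> u) u \<in> N" using u z by (simp add: N_def diff scl)
    then have "ip H (x - scl H (\<phi> x / \<phi> u) u) u = 0"
      unfolding u_def by (rule proj_orth_right[OF N])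
    then have "ip H x u = \<phi> x / \<phi> u * ip H u u" by (simp add: ip_diff_left ip_scl_left)
    then show ?thesis using u uu z by (simp add: ip_scl_right field_simps)
  qed
  then show thesis by (rule that)
qed

section \<open>Adjoints\<close>

text \<open>The adjoint is a choice among maps with the adjoint property, so it has the property only
  once such a map is known to exist; here the Riesz representation provides it.\<close>

lemma adj_subspaceD:
  assumes F: "bounded_op H (ip_subspace H V) F"
    and w: "w \<in> V"
  shows "ip H (F x) w = ip H x (adj H (ip_subspace H V) F w)"
proof -
  obtain C where C: "\<And>x. norm (F x) \<le> C * norm x"
    using F by (auto simp: bounded_op_def ip_subspace_def nrm_def norm_sq_ip)
  have "\<exists>y. \<forall>x. ip H (F x) w = ip H x y" for w
  proof (rule Riesz[of "\<lambda>x. ip H (F x) w" "C * norm w"])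
    show "ip H (F (x + y)) w = ip H (F x) w + ip H (F y) w" for x y
      using F by (simp add: bounded_op_def ip_add_left)
    show "ip H (F (scl H c x)) w = c * ip H (F x) w" for c x
      using F by (simp add: bounded_op_def ip_subspace_def ip_scl_left)
    show "norm (ip H (F x) w) \<le> C * norm w * norm x" for x
      using Cauchy_Schwarz[of "F x" w] mult_right_mono[OF C[of x], of "norm w"] by (simp add: ac_simps)
  qed blast
  then obtain G where G: "\<And>x w. ip H (F x) w = ip H x (G w)" by metis
  let ?P = "\<lambda>G. G \<in> carrier (ip_subspace H V) \<rightarrow> carrier H \<and>
     (\<forall>x\<in>carrier H. \<forall>y\<in>carrier (ip_subspace H V). ip (ip_subspace H V) (F x) y = ip H x (G y))"
  have "?P (SOME G. ?P G)"
    by (rule someI[of ?P G]) (simp add: ip_subspace_def G)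
  with w show ?thesis by (simp add: adj_def ip_subspace_def)
qed

text \<open>A formula with the adjoint property shows that the choice defining the adjoint is not
  empty, and since the carrier separates its own points, the chosen
  adjoint can only agree with the formula.\<close>

lemma adj_eqI:
  assumes G: "\<And>y. y \<in> carrier T \<Longrightarrow> G y \<in> carrier S"
    and adjoint: "\<And>x y. x \<in> carrier S \<Longrightarrow> y \<in> carrier T \<Longrightarrow> ip T (F x) y = ip S x (G y)"
    and separating: "\<And>a b. a \<in> carrier S \<Longrightarrow> b \<in> carrier S \<Longrightarrow>
      (\<And>x. x \<in> carrier S \<Longrightarrow> ip S x a = ip S x b) \<Longrightarrow> a = b"
    and y: "y \<in> carrier T"
  shows "adj S T F y = G y"
proof -
  let ?P = "\<lambda>G. G \<in> carrier T \<rightarrow> carrier S \<and>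
     (\<forall>x\<in>carrier S. \<forall>y\<in>carrier T. ip T (F x) y = ip S x (G y))"
  have "?P (SOME G. ?P G)"
    by (rule someI[of ?P G]) (simp add: G adjoint)
  then have *: "adj S T F y \<in> carrier S" "\<And>x. x \<in> carrier S \<Longrightarrow> ip T (F x) y = ip S x (adj S T F y)"
    using y unfolding adj_def[symmetric] by auto
  show ?thesis
    by (rule separating[OF *(1) G[OF y]]) (metis *(2) adjoint y)
qed

section \<open>Direct sums and diagonal operators\<close>

lemma nrm_direct_sum:
  assumes "f \<in> carrier (direct_sum H I W)"
  shows "nrm (direct_sum H I W) f = sqrt (\<Sum>\<^sub>\<infinity>i\<in>I. (norm (f i))\<^sup>2)"
proof -
  have "(\<lambda>i. (norm (f i))\<^sup>2) summable_on I" using assms by (simp add: direct_sum_def)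
  then have "((\<lambda>i. ip H (f i) (f i)) has_sum of_real (\<Sum>\<^sub>\<infinity>i\<in>I. (norm (f i))\<^sup>2)) I"
    unfolding ip_self by (intro has_sum_of_real has_sum_infsum)
  then show ?thesis
    by (simp add: nrm_def direct_sum_def infsumI infsum_nonneg)
qed

lemma direct_sum_right_eqI:
  assumes W: "\<And>i. i \<in> I \<Longrightarrow> subspace (W i)"
    and a: "a \<in> carrier (direct_sum H I W)" and b: "b \<in> carrier (direct_sum H I W)"
    and eq: "\<And>x. x \<in> carrier (direct_sum H I W) \<Longrightarrow>
      ip (direct_sum H I W) x a = ip (direct_sum H I W) x b"
  shows "a = b"
proof
  fix i
  show "a i = b i"
  proof (cases "i \<in> I")
    case True
    \<comment> \<open>test against the vector supported at \<open>i\<close>\<close>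
    define x where "x = (\<lambda>j. if j = i then a i - b i else 0)"
    have "a i - b i \<in> W i" using W a b True by (simp add: direct_sum_def subspace_diff)
    then have x: "x \<in> carrier (direct_sum H I W)"
      using W True by (auto simp: direct_sum_def x_def subspace_0 split: if_splits
          intro!: finite_nonzero_values_imp_summable_on[OF finite_subset[of _ "{i}"]])
    have "ip (direct_sum H I W) x y = ip H (a i - b i) (y i)" for y
      unfolding direct_sum_def ip_space.simps
      by (rule infsumI, rule has_sum_finite_neutralI[of "{i}"]) (use True in \<open>auto simp: x_def\<close>)
    with eq[OF x] have "ip H (a i - b i) (a i - b i) = 0" by (simp add: ip_diff_right)
    then show ?thesis by simp
  qed (use a b in \<open>simp add: direct_sum_def\<close>)
qed

text \<open>A uniform bound on the components is what keeps the image square summable.\<close>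

lemma direct_sum_diagonal_mem:
  assumes "\<And>i w. i \<in> I \<Longrightarrow> w \<in> W i \<Longrightarrow> A i w \<in> V i"
    and "\<And>i w. i \<in> I \<Longrightarrow> w \<in> W i \<Longrightarrow> norm (A i w) \<le> C * norm w"
    and f: "f \<in> carrier (direct_sum H I W)"
  shows "(\<lambda>i. if i \<in> I then A i (f i) else 0) \<in> carrier (direct_sum H I V)"
    and "(\<Sum>\<^sub>\<infinity>i\<in>I. (norm (A i (f i)))\<^sup>2) \<le> C\<^sup>2 * (\<Sum>\<^sub>\<infinity>i\<in>I. (norm (f i))\<^sup>2)"
proof -
  have f': "\<And>i. i \<in> I \<Longrightarrow> f i \<in> W i" "(\<lambda>i. (norm (f i))\<^sup>2) summable_on I"
    using f by (auto simp: direct_sum_def)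
  have le: "(norm (A i (f i)))\<^sup>2 \<le> C\<^sup>2 * (norm (f i))\<^sup>2" if "i \<in> I" for i
    using power_mono[OF assms(2)[OF that f'(1)[OF that]], of 2] by (simp add: power_mult_distrib)
  have sum: "(\<lambda>i. C\<^sup>2 * (norm (f i))\<^sup>2) summable_on I"
    by (rule summable_on_cmult_right) (rule f'(2))
  then have sumA: "(\<lambda>i. (norm (A i (f i)))\<^sup>2) summable_on I"
    by (rule summable_on_comparison_test) (use le in auto)
  then have "(\<lambda>i. (norm (if i \<in> I then A i (f i) else 0))\<^sup>2) summable_on I"
    by (rule summable_on_cong[THEN iffD1, rotated]) simp
  then show "(\<lambda>i. if i \<in> I then A i (f i) else 0) \<in> carrier (direct_sum H I V)"
    using assms(1) f'(1) by (simp add: direct_sum_def)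
  have "(\<Sum>\<^sub>\<infinity>i\<in>I. (norm (A i (f i)))\<^sup>2) \<le> (\<Sum>\<^sub>\<infinity>i\<in>I. C\<^sup>2 * (norm (f i))\<^sup>2)"
    by (rule infsum_mono[OF sumA sum le])
  also have "\<dots> = C\<^sup>2 * (\<Sum>\<^sub>\<infinity>i\<in>I. (norm (f i))\<^sup>2)"
    by (rule infsum_cmult_right) (rule f'(2))
  finally show "(\<Sum>\<^sub>\<infinity>i\<in>I. (norm (A i (f i)))\<^sup>2) \<le> C\<^sup>2 * (\<Sum>\<^sub>\<infinity>i\<in>I. (norm (f i))\<^sup>2)" .
qed

lemma bounded_op_diagonal:
  assumes mem: "\<And>i w. i \<in> I \<Longrightarrow> w \<in> W i \<Longrightarrow> A i w \<in> V i"
    and add: "\<And>i w w'. i \<in> I \<Longrightarrow> w \<in> W i \<Longrightarrow> w' \<in> W i \<Longrightarrow> A i (w + w') = A i w + A i w'"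
    and scl: "\<And>i c w. i \<in> I \<Longrightarrow> w \<in> W i \<Longrightarrow> A i (scl H c w) = scl H c (A i w)"
    and bound: "\<And>i w. i \<in> I \<Longrightarrow> w \<in> W i \<Longrightarrow> norm (A i w) \<le> C * norm w"
  shows "bounded_op (direct_sum H I W) (direct_sum H I V) (\<lambda>f i. if i \<in> I then A i (f i) else 0)"
    (is "bounded_op ?S ?T ?Q")
  unfolding bounded_op_def
proof (intro conjI ballI allI exI)
  show Q: "?Q \<in> carrier ?S \<rightarrow> carrier ?T"
    using direct_sum_diagonal_mem(1)[of I W A V C] mem bound by blast
  fix x assume x: "x \<in> carrier ?S"
  show "?Q (x + y) = ?Q x + ?Q y" if "y \<in> carrier ?S" for y
    using x that by (auto simp: direct_sum_def add)
  show "?Q (scl ?S c x) = scl ?T c (?Q x)" for c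
    using x by (auto simp: direct_sum_def scl)
  have "?Q x \<in> carrier ?T" using Q x by blast
  then have "nrm ?T (?Q x) = sqrt (\<Sum>\<^sub>\<infinity>i\<in>I. (norm (A i (x i)))\<^sup>2)"
    by (subst nrm_direct_sum) (auto intro: infsum_cong)
  also have "\<dots> \<le> sqrt (C\<^sup>2 * (\<Sum>\<^sub>\<infinity>i\<in>I. (norm (x i))\<^sup>2))"
    using direct_sum_diagonal_mem(2)[OF mem bound x] by simp
  also have "\<dots> = \<bar>C\<bar> * nrm ?S x"
    using x by (simp add: nrm_direct_sum real_sqrt_mult)
  finally show "nrm ?T (?Q x) \<le> \<bar>C\<bar> * nrm ?S x" .
qed

lemma adj_diagonal:
  assumes W: "\<And>i. i \<in> I \<Longrightarrow> subspace (W i)"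
    and mem: "\<And>i v. i \<in> I \<Longrightarrow> v \<in> V i \<Longrightarrow> B i v \<in> W i"
    and bound: "\<And>i v. i \<in> I \<Longrightarrow> v \<in> V i \<Longrightarrow> norm (B i v) \<le> C * norm v"
    and adjoint: "\<And>i v w. i \<in> I \<Longrightarrow> v \<in> V i \<Longrightarrow> w \<in> W i \<Longrightarrow> ip H (A i w) v = ip H w (B i v)"
    and g: "g \<in> carrier (direct_sum H I V)"
  shows "adj (direct_sum H I W) (direct_sum H I V) (\<lambda>f i. if i \<in> I then A i (f i) else 0) g
      = (\<lambda>i. if i \<in> I then B i (g i) else 0)"
proof (rule adj_eqI[OF _ _ _ g])
  show "(\<lambda>i. if i \<in> I then B i (y i) else 0) \<in> carrier (direct_sum H I W)"
    if "y \<in> carrier (direct_sum H I V)" for y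
    using direct_sum_diagonal_mem(1)[OF mem bound that] .
  show "ip (direct_sum H I V) (\<lambda>i. if i \<in> I then A i (x i) else 0) y
      = ip (direct_sum H I W) x (\<lambda>i. if i \<in> I then B i (y i) else 0)"
    if "x \<in> carrier (direct_sum H I W)" "y \<in> carrier (direct_sum H I V)" for x y
    using that by (auto simp: direct_sum_def adjoint intro!: infsum_cong)
qed (rule direct_sum_right_eqI[OF W])

end

section \<open>Synthesis operators of Bessel fusion sequences\<close>

text \<open>The Cauchy criterion for unconditional convergence: applied to finite sets beyond a large
  one, the hypothesis bounds the tails of \<open>f\<close> by those of \<open>g\<close>. It serves for series which, like
  orthogonal ones, need not converge absolutely.\<close>

lemma summable_on_if_norm_sq_le_sum:
  fixes f :: "'i \<Rightarrow> 'h::banach" and g :: "'i \<Rightarrow> real"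
  assumes g: "g summable_on A"
    and le: "\<And>F. finite F \<Longrightarrow> F \<subseteq> A \<Longrightarrow> (norm (sum f F))\<^sup>2 \<le> B * sum g F"
  shows "f summable_on A"
proof -
  have "\<exists>P. eventually P (finite_subsets_at_top A) \<and>
      (\<forall>F F'. P F \<and> P F' \<longrightarrow> dist (sum f F) (sum f F') < e)" if "e > 0" for e
  proof -
    define d where "d = (e / 2)\<^sup>2 / (2 * (\<bar>B\<bar> + 1))"
    have d: "d > 0" "\<bar>B\<bar> * (2 * d) < (e / 2)\<^sup>2"
      using that by (auto simp: d_def field_simps intro!: add_pos_nonneg)
    have "(sum g \<longlongrightarrow> infsum g A) (finite_subsets_at_top A)"
      using g by (simp add: infsum_tendsto)
    then have "\<forall>\<^sub>F F in finite_subsets_at_top A. dist (sum g F) (infsum g A) < d"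
      by (rule tendstoD) (rule d)
    then obtain F0 where F0: "finite F0" "F0 \<subseteq> A"
      and near: "\<And>F. finite F \<Longrightarrow> F0 \<subseteq> F \<Longrightarrow> F \<subseteq> A \<Longrightarrow> dist (sum g F) (infsum g A) < d"
      by (auto simp: eventually_finite_subsets_at_top)
    \<comment> \<open>beyond \<open>F0\<close> the controlling series has tails below \<open>2 * d\<close>, and \<open>d\<close> was chosen so that
      \<open>B\<close> times this is below \<open>(e / 2)\<^sup>2\<close>\<close>
    have tail: "dist (sum f F) (sum f F0) < e / 2" if F: "finite F" "F0 \<subseteq> F" "F \<subseteq> A" for F
    proof -
      have "\<bar>sum g (F - F0)\<bar> < 2 * d"
        using near[OF F] near[OF F0(1) order_refl F0(2)] F
        by (simp add: sum_diff dist_real_def abs_less_iff)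
      then have "\<bar>B\<bar> * \<bar>sum g (F - F0)\<bar> \<le> \<bar>B\<bar> * (2 * d)"
        by (intro mult_left_mono) auto
      moreover have "B * sum g (F - F0) \<le> \<bar>B\<bar> * \<bar>sum g (F - F0)\<bar>"
        by (metis abs_ge_self abs_mult)
      moreover have "(norm (sum f (F - F0)))\<^sup>2 \<le> B * sum g (F - F0)"
        by (rule le) (use F in auto)
      ultimately have "(norm (sum f (F - F0)))\<^sup>2 < (e / 2)\<^sup>2" using d(2) by linarith
      then have "norm (sum f (F - F0)) < e / 2" by (rule power2_less_imp_less) (use \<open>e > 0\<close> in simp)
      then show ?thesis using F by (simp add: sum_diff dist_norm)
    qed
    define P where "P F \<longleftrightarrow> finite F \<and> F0 \<subseteq> F \<and> F \<subseteq> A" for F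
    have "dist (sum f F) (sum f F') < e" if "P F" "P F'" for F F'
      using tail[of F] tail[of F'] that[unfolded P_def] dist_triangle2[of "sum f F" "sum f F'" "sum f F0"] by force
    moreover have "eventually P (finite_subsets_at_top A)"
      using F0 by (auto simp: P_def eventually_finite_subsets_at_top)
    ultimately show ?thesis by blast
  qed
  then have "cauchy_filter (filtermap (sum f) (finite_subsets_at_top A))"
    by (simp add: cauchy_filter_metric_filtermap)
  moreover have "complete (UNIV :: 'h set)"
    by (meson Cauchy_convergent UNIV_I complete_def convergent_def)
  ultimately obtain L where "(sum f \<longlongrightarrow> L) (finite_subsets_at_top A)"
    using complete_uniform[where S = "UNIV :: 'h set"] by (force simp add: filterlim_def)
  then show ?thesis using summable_on_def has_sum_def by blast
qed

context hilbert
begin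

text \<open>In the zero space a negative constant also satisfies the Bessel inequality; taking absolute
  values rules it out.\<close>

lemma bessel_bound:
  assumes "bessel_fusion_sequence H I V \<upsilon>"
  obtains B where "B \<ge> 0"
    "\<And>f. (\<lambda>i. (\<upsilon> i)\<^sup>2 * (norm (proj H (V i) f))\<^sup>2) summable_on I"
    "\<And>f. (\<Sum>\<^sub>\<infinity>i\<in>I. (\<upsilon> i)\<^sup>2 * (norm (proj H (V i) f))\<^sup>2) \<le> B * (norm f)\<^sup>2"
proof -
  obtain B where B: "\<And>f. (\<lambda>i. (\<upsilon> i)\<^sup>2 * (norm (proj H (V i) f))\<^sup>2) summable_on I"
    "\<And>f. (\<Sum>\<^sub>\<infinity>i\<in>I. (\<upsilon> i)\<^sup>2 * (norm (proj H (V i) f))\<^sup>2) \<le> B * (norm f)\<^sup>2"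
    using assms unfolding bessel_fusion_sequence_def by metis
  show thesis
    by (rule that[of "\<bar>B\<bar>"])
      (use B in \<open>auto intro: order_trans[OF _ mult_right_mono[OF abs_ge_self]]\<close>)
qed

text \<open>The synthesis series converges. For a finite partial sum \<open>s\<close>, the square \<open>\<parallel>s\<parallel>\<^sup>2\<close> is the sum of
  the inner products of its terms with \<open>s\<close>, in which \<open>s\<close> may be replaced by its projections. The
  Cauchy-Schwarz inequality for sums and the Bessel bound at \<open>s\<close> then give
  \<open>\<parallel>s\<parallel>\<^sup>4 \<le> (\<Sum>i\<in>F. \<parallel>x i\<parallel>\<^sup>2) * B * \<parallel>s\<parallel>\<^sup>2\<close>, and \<open>\<parallel>s\<parallel>\<^sup>2\<close> cancels.\<close>

lemma bessel_summable:
  assumes V: "bessel_fusion_sequence H I V \<upsilon>"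
    and x: "x \<in> carrier (direct_sum H I V)"
  shows "(\<lambda>i. \<upsilon> i *\<^sub>R x i) summable_on I"
proof -
  have sub: "\<And>i. i \<in> I \<Longrightarrow> closed_subspace H (V i)"
    using V by (simp add: bessel_fusion_sequence_def)
  obtain B where B0: "B \<ge> 0"
    and B: "\<And>f. (\<lambda>i. (\<upsilon> i)\<^sup>2 * (norm (proj H (V i) f))\<^sup>2) summable_on I"
      "\<And>f. (\<Sum>\<^sub>\<infinity>i\<in>I. (\<upsilon> i)\<^sup>2 * (norm (proj H (V i) f))\<^sup>2) \<le> B * (norm f)\<^sup>2"
    by (rule bessel_bound[OF V]) blast
  have xV: "\<And>i. i \<in> I \<Longrightarrow> x i \<in> V i" and xs: "(\<lambda>i. (norm (x i))\<^sup>2) summable_on I"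
    using x by (auto simp: direct_sum_def)
  show ?thesis
  proof (rule summable_on_if_norm_sq_le_sum[OF xs])
    fix F assume F: "finite F" "F \<subseteq> I"
    define s where "s = (\<Sum>i\<in>F. \<upsilon> i *\<^sub>R x i)"
    define p where "p i = \<upsilon> i *\<^sub>R proj H (V i) s" for i
    have "ip H (\<upsilon> i *\<^sub>R x i) s = \<upsilon> i *\<^sub>R ip H (x i) (proj H (V i) s)" if "i \<in> F" for i
    proof -
      have "i \<in> I" using that F(2) by blast
      from proj_orth_right[OF sub[OF this] xV[OF this], of s] show ?thesis
        by (simp add: ip_scaleR_left ip_diff_right)
    qed
    then have "ip H s s = (\<Sum>i\<in>F. \<upsilon> i *\<^sub>R ip H (x i) (proj H (V i) s))"
      unfolding s_def ip_sum_left by (simp add: s_def)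
    then have "(norm s)\<^sup>2 = norm (\<Sum>i\<in>F. \<upsilon> i *\<^sub>R ip H (x i) (proj H (V i) s))"
      by (simp flip: norm_sq_ip)
    also have "\<dots> \<le> (\<Sum>i\<in>F. norm (x i) * norm (p i))"
    proof (rule sum_norm_le)
      fix i
      show "norm (\<upsilon> i *\<^sub>R ip H (x i) (proj H (V i) s)) \<le> norm (x i) * norm (p i)"
        using mult_left_mono[OF Cauchy_Schwarz[of "x i" "proj H (V i) s"], of "\<bar>\<upsilon> i\<bar>"]
        by (simp add: p_def ac_simps)
    qed
    finally have "((norm s)\<^sup>2)\<^sup>2 \<le> (\<Sum>i\<in>F. norm (x i) * norm (p i))\<^sup>2"
      by (rule power_mono) simp
    also have "\<dots> \<le> (\<Sum>i\<in>F. (norm (x i))\<^sup>2) * (\<Sum>i\<in>F. (norm (p i))\<^sup>2)"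
      by (rule Cauchy_Schwarz_ineq_sum)
    also have "\<dots> \<le> (\<Sum>i\<in>F. (norm (x i))\<^sup>2) * (B * (norm s)\<^sup>2)"
    proof (rule mult_left_mono)
      show "(\<Sum>i\<in>F. (norm (p i))\<^sup>2) \<le> B * (norm s)\<^sup>2"
        using finite_sum_le_infsum[OF B(1)[of s] F] B(2)[of s]
        by (simp add: p_def power_mult_distrib)
    qed (simp add: sum_nonneg)
    finally have *: "(norm s)\<^sup>2 * (norm s)\<^sup>2 \<le> (B * (\<Sum>i\<in>F. (norm (x i))\<^sup>2)) * (norm s)\<^sup>2"
      by (simp only: power2_eq_square[of "(norm s)\<^sup>2"] ac_simps)
    show "(norm (\<Sum>i\<in>F. \<upsilon> i *\<^sub>R x i))\<^sup>2 \<le> B * (\<Sum>i\<in>F. (norm (x i))\<^sup>2)"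
    proof (cases "s = 0")
      case False
      then have "(norm s)\<^sup>2 \<le> B * (\<Sum>i\<in>F. (norm (x i))\<^sup>2)"
        by (intro mult_right_le_imp_le[OF *]) simp
      then show ?thesis by (simp only: s_def)
    next
      case True
      then show ?thesis using B0 by (simp add: s_def[symmetric] sum_nonneg)
    qed
  qed
qed

lemma analysis_mem:
  assumes V: "bessel_fusion_sequence H I V \<upsilon>"
  shows "(\<lambda>i. if i \<in> I then \<upsilon> i *\<^sub>R proj H (V i) f else 0) \<in> carrier (direct_sum H I V)"
proof -
  have "\<upsilon> i *\<^sub>R proj H (V i) f \<in> V i" if "i \<in> I" for i
  proof -
    have "closed_subspace H (V i)" using V that by (simp add: bessel_fusion_sequence_def)
    then show ?thesis
      using proj_in[of "V i" f] by (simp add: closed_subspace_def subspace_scale flip: scl_of_real)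
  qed
  moreover have "(\<lambda>i. (norm (if i \<in> I then \<upsilon> i *\<^sub>R proj H (V i) f else 0))\<^sup>2) summable_on I
      \<longleftrightarrow> (\<lambda>i. (\<upsilon> i)\<^sup>2 * (norm (proj H (V i) f))\<^sup>2) summable_on I"
    by (rule summable_on_cong) (simp add: power_mult_distrib)
  ultimately show ?thesis
    using V by (auto simp: direct_sum_def bessel_fusion_sequence_def)
qed

lemma adj_synthesis:
  assumes V: "bessel_fusion_sequence H I V \<upsilon>"
  shows "adj (direct_sum H I V) H (synthesis I \<upsilon>) f
    = (\<lambda>i. if i \<in> I then \<upsilon> i *\<^sub>R proj H (V i) f else 0)"
proof -
  have sub: "\<And>i. i \<in> I \<Longrightarrow> closed_subspace H (V i)"
    using V by (simp add: bessel_fusion_sequence_def)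
  show ?thesis
  proof (rule adj_eqI)
    fix f
    show "(\<lambda>i. if i \<in> I then \<upsilon> i *\<^sub>R proj H (V i) f else 0) \<in> carrier (direct_sum H I V)"
      by (rule analysis_mem[OF V])
    fix x assume x: "x \<in> carrier (direct_sum H I V)"
    then have xV: "\<And>i. i \<in> I \<Longrightarrow> x i \<in> V i" by (simp add: direct_sum_def)
    have "((\<lambda>i. ip H (\<upsilon> i *\<^sub>R x i) f) has_sum ip H (synthesis I \<upsilon> x) f) I"
      unfolding synthesis_def
      by (rule has_sum_bounded_linear[OF bounded_linear_ip_left])
        (rule has_sum_infsum[OF bessel_summable[OF V x]])
    then have "ip H (synthesis I \<upsilon> x) f = (\<Sum>\<^sub>\<infinity>i\<in>I. ip H (\<upsilon> i *\<^sub>R x i) f)"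
      by (simp add: infsumI)
    also have "\<dots> = (\<Sum>\<^sub>\<infinity>i\<in>I. ip H (x i) (if i \<in> I then \<upsilon> i *\<^sub>R proj H (V i) f else 0))"
    proof (rule infsum_cong)
      fix i assume i: "i \<in> I"
      have "ip H (x i) f = ip H (x i) (proj H (V i) f)"
        using proj_orth_right[OF sub[OF i] xV[OF i], of f] by (simp add: ip_diff_right)
      then show "ip H (\<upsilon> i *\<^sub>R x i) f = ip H (x i) (if i \<in> I then \<upsilon> i *\<^sub>R proj H (V i) f else 0)"
        using i by (simp add: ip_scl_left ip_scl_right flip: scl_of_real)
    qed
    finally show "ip H (synthesis I \<upsilon> x) f
        = ip (direct_sum H I V) x (\<lambda>i. if i \<in> I then \<upsilon> i *\<^sub>R proj H (V i) f else 0)"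
      by (simp add: direct_sum_def)
  next
    show "a = b" if "a \<in> carrier (direct_sum H I V)" "b \<in> carrier (direct_sum H I V)"
      "\<And>x. x \<in> carrier (direct_sum H I V) \<Longrightarrow>
        ip (direct_sum H I V) x a = ip (direct_sum H I V) x b" for a b
      by (rule direct_sum_right_eqI[OF _ that]) (use sub in \<open>simp add: closed_subspace_def\<close>)
  qed simp
qed

section \<open>The dual built from the components of a factorization\<close>

text \<open>One constant serves all components, since no component of \<open>X x\<close> is longer than \<open>X x\<close>.\<close>

lemma component_bounded_op:
  assumes X: "bounded_op H (direct_sum H I W) X"
  obtains C where "C \<ge> 0" "\<And>i x. i \<in> I \<Longrightarrow> norm (X x i) \<le> C * norm x"
    and "\<And>i. i \<in> I \<Longrightarrow> bounded_op H (ip_subspace H (W i)) (\<lambda>x. X x i)"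
proof -
  have mem: "\<And>x. X x \<in> carrier (direct_sum H I W)"
    using X by (auto simp: bounded_op_def)
  obtain D where D: "\<And>x. nrm (direct_sum H I W) (X x) \<le> D * norm x"
    using X by (auto simp: bounded_op_def nrm_eq_norm)
  have C: "norm (X x i) \<le> \<bar>D\<bar> * norm x" if "i \<in> I" for i x
  proof -
    have "(\<lambda>i. (norm (X x i))\<^sup>2) summable_on I" using mem[of x] by (simp add: direct_sum_def)
    from finite_sum_le_infsum[OF this, of "{i}"] that
    have "(norm (X x i))\<^sup>2 \<le> (\<Sum>\<^sub>\<infinity>i\<in>I. (norm (X x i))\<^sup>2)" by simp
    then have "norm (X x i) \<le> nrm (direct_sum H I W) (X x)"
      by (simp add: nrm_direct_sum[OF mem] real_le_rsqrt)
    also have "\<dots> \<le> \<bar>D\<bar> * norm x"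
      by (rule order_trans[OF D]) (simp add: mult_right_mono)
    finally show ?thesis .
  qed
  have "bounded_op H (ip_subspace H (W i)) (\<lambda>x. X x i)" if "i \<in> I" for i
    unfolding bounded_op_def
  proof (intro conjI ballI allI exI)
    show "(\<lambda>x. X x i) \<in> carrier H \<rightarrow> carrier (ip_subspace H (W i))"
      using mem that by (auto simp: direct_sum_def ip_subspace_def)
    show "X (x + y) i = X x i + X y i" for x y
      using X by (simp add: bounded_op_def)
    show "X (scl H c x) i = scl (ip_subspace H (W i)) c (X x i)" for c x
      using X by (simp add: bounded_op_def direct_sum_def ip_subspace_def)
    show "nrm (ip_subspace H (W i)) (X x i) \<le> \<bar>D\<bar> * nrm H x" for x
      using C[OF that, of x] by (simp add: nrm_def ip_subspace_def norm_sq_ip)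
  qed
  then show thesis using that[of "\<bar>D\<bar>"] C by simp
qed

text \<open>The orthogonal complement of the range of the adjoint of \<open>F\<close> is the kernel of \<open>F\<close>, so \<open>F\<close>
  does not see the part of \<open>f\<close> that the projection onto that range removes.\<close>

lemma bounded_op_proj_adj_range:
  assumes F: "bounded_op H (ip_subspace H V) F"
    and closed: "closed_subspace H (adj H (ip_subspace H V) F ` V)"
  shows "F (proj H (adj H (ip_subspace H V) F ` V) f) = F f"
proof -
  let ?R = "adj H (ip_subspace H V) F ` V"
  let ?d = "f - proj H ?R f"
  have "F (?d + proj H ?R f) = F ?d + F (proj H ?R f)"
    using F unfolding bounded_op_def carrier by blast
  moreover have "F ?d \<in> V" using F by (auto simp: bounded_op_def ip_subspace_def)
  then have "ip H (F ?d) (F ?d) = 0"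
    using adj_subspaceD[OF F] proj_orth[OF closed] by simp
  ultimately show ?thesis by simp
qed

end

theorem theorem3p3:
  fixes H :: "('k::real_or_complex, 'h::banach) ip_space"
    and I :: "'i set"
    and K :: "'h \<Rightarrow> 'h"
    and W :: "'i \<Rightarrow> 'h set" and \<omega> :: "'i \<Rightarrow> real"
    and X :: "'h \<Rightarrow> 'i \<Rightarrow> 'h"
    and What :: "'i \<Rightarrow> 'h set"
  assumes "hilbert_space H"
    and "separable_space (euclidean :: 'h topology)"
    and "countable I"
    and "bounded_op H H K"
    and "K_fusion_frame H I K W \<omega>"
    and "bounded_op H (direct_sum H I W) X"
    and "\<forall>f. synthesis I \<omega> (X f) = K f"
    and What_def: "\<forall>i\<in>I. What i = adj H (ip_subspace H (W i)) (\<lambda>f. X f i) ` W i"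
    and "bessel_fusion_sequence H I What (\<lambda>_. 1)"
  shows "QK_dual H I K W \<omega> What (\<lambda>_. 1)"
proof -
  interpret hilbert H by unfold_locales fact
  note X = \<open>bounded_op H (direct_sum H I W) X\<close>
    and bessel = \<open>bessel_fusion_sequence H I What (\<lambda>_. 1)\<close>
  have W: "\<And>i. i \<in> I \<Longrightarrow> subspace (W i)"
    using \<open>K_fusion_frame H I K W \<omega>\<close>
    by (simp add: K_fusion_frame_def bessel_fusion_sequence_def closed_subspace_def)
  obtain C where C: "C \<ge> 0" "\<And>i x. i \<in> I \<Longrightarrow> norm (X x i) \<le> C * norm x"
    and Xi: "\<And>i. i \<in> I \<Longrightarrow> bounded_op H (ip_subspace H (W i)) (\<lambda>x. X x i)"
    using component_bounded_op[OF X] by blast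
  define A where "A i = adj H (ip_subspace H (W i)) (\<lambda>f. X f i)" for i
  \<comment> \<open>only the adjoint relation is known of the values of \<open>A i\<close> on \<open>W i\<close>; linearity and the
    bound are read off from it below\<close>
  have A: "ip H (X x i) w = ip H x (A i w)" if "i \<in> I" "w \<in> W i" for i w x
    unfolding A_def by (rule adj_subspaceD[OF Xi[OF that(1)] that(2)])
  have A': "ip H (A i w) x = ip H w (X x i)" if "i \<in> I" "w \<in> W i" for i w x
    using A[OF that] by (metis ip_commute)
  have X_proj: "X (proj H (What i) f) i = X f i" if "i \<in> I" for i f
    using bounded_op_proj_adj_range[OF Xi[OF that]] bessel that What_def
    by (simp add: bessel_fusion_sequence_def)
  let ?Q = "\<lambda>f i. if i \<in> I then A i (f i) else 0"
  have "bounded_op (direct_sum H I W) (direct_sum H I What) ?Q"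
  proof (rule bounded_op_diagonal)
    fix i w assume i: "i \<in> I" and w: "w \<in> W i"
    show "A i w \<in> What i" using i w What_def by (simp add: A_def)
    show "A i (w + w') = A i w + A i w'" if "w' \<in> W i" for w'
      by (rule ip_right_eqI)
        (use i w that W in \<open>simp add: ip_add_right subspace_add flip: A\<close>)
    show "A i (scl H c w) = scl H c (A i w)" for c
      by (rule ip_right_eqI)
        (use i w W in \<open>simp add: ip_scl_right subspace_scale flip: A\<close>)
    have "(norm (A i w))\<^sup>2 = norm (ip H (X (A i w) i) w)"
      by (simp add: A[OF i w] norm_sq_ip)
    also have "\<dots> \<le> norm (X (A i w) i) * norm w" by (rule Cauchy_Schwarz)
    also have "\<dots> \<le> C * norm (A i w) * norm w"
      by (intro mult_right_mono C i norm_ge_zero)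
    finally show "norm (A i w) \<le> C * norm w"
      using C(1) by (cases "A i w = 0") (auto simp: power2_eq_square)
  qed
  moreover have "synthesis I \<omega> (adj (direct_sum H I W) (direct_sum H I What) ?Q
        (adj (direct_sum H I What) H (synthesis I (\<lambda>_. 1)) f)) = K f" for f
  proof -
    let ?g = "\<lambda>i. if i \<in> I then proj H (What i) f else 0"
    have T: "adj (direct_sum H I What) H (synthesis I (\<lambda>_. 1)) f = ?g"
      using adj_synthesis[OF bessel, of f] by (simp cong: if_cong)
    have g: "?g \<in> carrier (direct_sum H I What)"
      using analysis_mem[OF bessel, of f] by (simp cong: if_cong)
    have "adj (direct_sum H I W) (direct_sum H I What) ?Q ?g
        = (\<lambda>i. if i \<in> I then X (?g i) i else 0)"
    proof (rule adj_diagonal[OF W _ _ _ g, where B = "\<lambda>i v. X v i"])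
      show "X v i \<in> W i" if "i \<in> I" for i v
        using Xi[OF that] by (auto simp: bounded_op_def ip_subspace_def)
    qed (use C A' in auto)
    also have "\<dots> = X f"
    proof -
      have "X f \<in> carrier (direct_sum H I W)" using X by (auto simp: bounded_op_def)
      then show ?thesis by (auto simp: fun_eq_iff direct_sum_def X_proj)
    qed
    finally show ?thesis using T \<open>\<forall>f. synthesis I \<omega> (X f) = K f\<close> by simp
  qed
  ultimately show ?thesis
    using \<open>K_fusion_frame H I K W \<omega>\<close> bessel unfolding QK_dual_def by blast
qed

end
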